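(* Let $G$ be a graph on $n$ vertices, let $c\ge2$, and let $H_1,\dots,H_n$ be graphs on $c$ vertices. The edge-perturbed blow-up $\overset{c}{\uplus}\,G[H_1,\dots,H_n]$ exhibits perfect (resp., pretty good) state transfer between two real pure states whenever some $H_j$ such that the all-ones vector $\mathbf{1}$ is an eigenvector of $M(H_j)$ admits perfect (resp., pretty good) state transfer between two real pure states orthogonal to $\mathbf{1}$. In particular, $\overset{c}{\uplus}\,G[H_1,\dots,H_n]$ admits pair PST (resp., pair PGST) whenever some $H_j$ such that $\mathbf{1}$ is an eigenvector of $M(H_j)$ admits pair PST (resp., pair PGST).
   Context: $A$ is the adjacency matrix of a graph, $\Delta$ the diagonal matrix of row sums of $A$, $L=\Delta-A$, $Q=\Delta+A$; $M$ denotes any one of $A,L,Q$ (same choice for all graphs), and $U_X(t)=\exp(itM(X))$. The blow-up $\overset{c}{\uplus}\,G$ is obtained by replacing each vertex of $G$ by an independent set (cluster) of size $c$, vertices in different clusters being adjacent if and only if the corresponding vertices of $G$ are adjacent (with the edge weight inherited from $G$). $\overset{c}{\uplus}\,G[H_1,\dots,H_n]$ is the graph obtained from it by replacing the $j$-th cluster by $H_j$ (i.e. adding the edges of $H_j$ on it) for $j=1,\dots,n$. Real pure states are represented by nonzero real vectors. Perfect state transfer (PST) between $\mathbf{x}$ and $\mathbf{y}$ (with $\mathbf{y}\ne\pm\mathbf{x}$, of equal norm) in $X$ means $U_X(\tau)\mathbf{x}=\gamma\mathbf{y}$ for some $\tau>0$, $\gamma\in\mathbb{C}$; pretty good state transfer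 (PGST) means $\lim_k U_X(t_k)\mathbf{x}=\gamma\mathbf{y}$ for some real sequence $(t_k)$ and $\gamma\in\mathbb{C}$. Pair PST (PGST) is PST (PGST) between two states of the form $\mathbf{e}_a-\mathbf{e}_b$ and $\mathbf{e}_p-\mathbf{e}_q$ with $a\ne b$, $p\neq q$ vertices, where $\mathbf{e}_a$ is the characteristic vector of $a$. *)

theory Defs
  imports "HOL-Analysis.Analysis"
begin

text \<open>
  A finite undirected graph with vertex set \<open>UNIV :: 'v set\<close> is given by its edge-weight function:
  \<open>w u v \<noteq> 0\<close> iff \<open>u\<close> and \<open>v\<close> are adjacent, and then \<open>w u v\<close> is the weight of the edge.
  There are no loops; unweighted graphs are those with weights in \<open>{0, 1}\<close>.
\<close>

type_synonym 'v graph = "'v \<Rightarrow> 'v \<Rightarrow> real"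

definition is_graph :: "'v graph \<Rightarrow> bool" where
  "is_graph w \<longleftrightarrow> (\<forall>u v. w u v = w v u) \<and> (\<forall>v. w v v = 0)"

definition adjacency_matrix :: "'v::finite graph \<Rightarrow> real^'v^'v" where
  "adjacency_matrix w = (\<chi> u v. w u v)"

definition row_sum_matrix :: "'v::finite graph \<Rightarrow> real^'v^'v" where
  "row_sum_matrix w = (\<chi> u v. if u = v then (\<Sum>x\<in>UNIV. adjacency_matrix w $ u $ x) else 0)"

text \<open>
  A datatype, rather than a function on graphs, names the choice of Hamiltonian, because one and
  the same choice has to be applied to graphs on different vertex types.
\<close>

datatype hamiltonian = Adjacency | Laplacian | Signless_Laplacian

fun graph_matrix :: "hamiltonian \<Rightarrow> 'v::finite graph \<Rightarrow> real^'v^'v" where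
  "graph_matrix Adjacency w = adjacency_matrix w"
| "graph_matrix Laplacian w = row_sum_matrix w - adjacency_matrix w"
| "graph_matrix Signless_Laplacian w = row_sum_matrix w + adjacency_matrix w"

definition is_eigenvector :: "real^'v^'v \<Rightarrow> real^'v \<Rightarrow> bool" where
  "is_eigenvector A x \<longleftrightarrow> x \<noteq> 0 \<and> (\<exists>\<mu>. A *v x = \<mu> *s x)"

text \<open>
  The vertex \<open>(j, a)\<close> of the blow-up is the \<open>a\<close>-th vertex of the \<open>j\<close>-th cluster; the cluster
  size is the cardinality of \<open>'c\<close>.
\<close>

definition blow_up :: "'n graph \<Rightarrow> ('n \<times> 'c) graph" where
  "blow_up G = (\<lambda>(j, a) (k, b). if j = k then 0 else G j k)"

definition perturbed_blow_up :: "'n graph \<Rightarrow> ('n \<Rightarrow> 'c graph) \<Rightarrow> ('n \<times> 'c) graph" where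
  "perturbed_blow_up G H =
     (\<lambda>(j, a) (k, b). if j = k then H j a b else blow_up G (j, a) (k, b))"

lemma is_graph_blow_up: "is_graph G \<Longrightarrow> is_graph (blow_up G)"
  by (auto simp: is_graph_def blow_up_def)

lemma is_graph_perturbed_blow_up:
  "is_graph G \<Longrightarrow> (\<And>j. is_graph (H j)) \<Longrightarrow> is_graph (perturbed_blow_up G H)"
  by (auto simp: is_graph_def perturbed_blow_up_def blow_up_def)

text \<open>
  The type of square matrices is not an instance of the normed-algebra classes (its
  multiplication \<open>*\<close> is entrywise), so \<open>power\<close> and \<open>exp\<close> do not give the matrix notions.
\<close>

primrec matrix_pow :: "complex^'v^'v \<Rightarrow> nat \<Rightarrow> complex^'v^'v" where
  "matrix_pow A 0 = mat 1"
| "matrix_pow A (Suc k) = A ** matrix_pow A k"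

definition matrix_exp :: "complex^'v^'v \<Rightarrow> complex^'v^'v" where
  "matrix_exp A = (\<Sum>k. matrix_pow A k /\<^sub>R fact k)"

definition transition_matrix :: "hamiltonian \<Rightarrow> 'v::finite graph \<Rightarrow> real \<Rightarrow> complex^'v^'v" where
  "transition_matrix M X t =
     matrix_exp (map_matrix (\<lambda>m. \<i> * complex_of_real t * complex_of_real m) (graph_matrix M X))"

definition cvec :: "real^'v \<Rightarrow> complex^'v" where
  "cvec x = (\<chi> v. complex_of_real (x $ v))"

definition distinct_real_pure_states :: "real^'v \<Rightarrow> real^'v \<Rightarrow> bool" where
  "distinct_real_pure_states x y \<longleftrightarrow>
     x \<noteq> 0 \<and> y \<noteq> 0 \<and> norm x = norm y \<and> y \<noteq> x \<and> y \<noteq> - x"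

definition PST :: "hamiltonian \<Rightarrow> 'v::finite graph \<Rightarrow> real^'v \<Rightarrow> real^'v \<Rightarrow> bool" where
  "PST M X x y \<longleftrightarrow> distinct_real_pure_states x y \<and>
     (\<exists>\<tau>>0. \<exists>\<gamma>. transition_matrix M X \<tau> *v cvec x = \<gamma> *s cvec y)"

definition PGST :: "hamiltonian \<Rightarrow> 'v::finite graph \<Rightarrow> real^'v \<Rightarrow> real^'v \<Rightarrow> bool" where
  "PGST M X x y \<longleftrightarrow> distinct_real_pure_states x y \<and>
     (\<exists>(t :: nat \<Rightarrow> real) \<gamma>. (\<lambda>k. transition_matrix M X (t k) *v cvec x) \<longlonglongrightarrow> \<gamma> *s cvec y)"

definition pair_state :: "'v::finite \<Rightarrow> 'v \<Rightarrow> real^'v" where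
  "pair_state a b = axis a 1 - axis b 1"

definition pair_PST :: "hamiltonian \<Rightarrow> 'v::finite graph \<Rightarrow> bool" where
  "pair_PST M X \<longleftrightarrow>
     (\<exists>a b p q. a \<noteq> b \<and> p \<noteq> q \<and> PST M X (pair_state a b) (pair_state p q))"

definition pair_PGST :: "hamiltonian \<Rightarrow> 'v::finite graph \<Rightarrow> bool" where
  "pair_PGST M X \<longleftrightarrow>
     (\<exists>a b p q. a \<noteq> b \<and> p \<noteq> q \<and> PGST M X (pair_state a b) (pair_state p q))"

end

theory Submission
  imports Defs
begin

text \<open>
  A state orthogonal to the all-ones vector and supported on the \<open>j\<close>-th cluster does not leak into
  the other clusters: the edges between two clusters have a constant weight, so their contributions
  cancel. On such states the Hamiltonian of the blow-up acts as that of \<open>H j\<close> plus a scalar \<open>d\<close>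
  (the degree into the other clusters, or 0 for the adjacency matrix). Since the all-ones vector is
  an eigenvector of a symmetric matrix, its orthogonal complement is invariant, and therefore the
  two evolutions agree on it up to the phase \<open>exp (i t d)\<close>.
\<close>

section \<open>The matrix exponential\<close>

text \<open>Each further factor \<open>A\<close> turns an entry into a sum of
  \<open>CARD('v)\<close> products, every one gaining a factor of norm at most
  \<open>B\<close>.\<close>

lemma norm_matrix_pow_entry_le:
  fixes A :: "complex^'v^'v"
  assumes "\<And>i j. norm (A $ i $ j) \<le> B"
  shows "norm (matrix_pow A k $ i $ j) \<le> (real CARD('v) * B) ^ k"
proof (induction k arbitrary: i)
  case 0
  show ?case by (simp add: mat_def)
next
  case (Suc k)
  have "norm (matrix_pow A (Suc k) $ i $ j) \<le> (\<Sum>l\<in>UNIV. norm (A $ i $ l * matrix_pow A k $ l $ j))"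
    by (simp add: matrix_matrix_mult_def norm_sum)
  also have "\<dots> \<le> (\<Sum>l\<in>(UNIV::'v set). B * (real CARD('v) * B) ^ k)"
    using assms Suc order_trans[OF norm_ge_zero assms]
    by (intro sum_mono) (simp add: norm_mult mult_mono)
  finally show ?case by simp
qed

text \<open>Domination by a real exponential series. Absolute convergence is what the Cauchy product
  in \<open>matrix_exp_add_mat\<close> calls for.\<close>

lemma summable_norm_matrix_exp_entry:
  fixes A :: "complex^'v^'v"
  shows "summable (\<lambda>k. norm ((matrix_pow A k /\<^sub>R fact k) $ i $ j))"
proof -
  \<comment> \<open>The sum of the norms of all entries is a crude uniform bound on each of
    them.\<close>
  define B where "B = (\<Sum>i\<in>UNIV. \<Sum>j\<in>UNIV. norm (A $ i $ j))"
  have B: "norm (A $ i $ j) \<le> B" for i j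
  proof -
    have "norm (A $ i $ j) \<le> (\<Sum>j\<in>UNIV. norm (A $ i $ j))"
      by (intro member_le_sum) auto
    also have "\<dots> \<le> B"
      unfolding B_def by (intro member_le_sum) (auto intro: sum_nonneg)
    finally show ?thesis .
  qed
  show ?thesis
  proof (rule summable_comparison_test'[OF summable_exp])
    fix k
    show "norm (norm ((matrix_pow A k /\<^sub>R fact k) $ i $ j)) \<le> inverse (fact k) * (real CARD('v) * B) ^ k"
      using norm_matrix_pow_entry_le[OF B, of k i j]
      by (simp add: mult_left_mono)
  qed
qed

lemma sums_vecI:
  fixes f :: "nat \<Rightarrow> ('a::real_normed_vector)^'v"
  assumes "\<And>i. (\<lambda>k. f k $ i) sums (l $ i)"
  shows "f sums l"
  using assms unfolding sums_def by (intro vec_tendstoI) (simp add: sum_component)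

text \<open>The \<open>suminf\<close> in \<open>matrix_exp\<close> carries information only once
  convergence is known; it is obtained entry by entry.\<close>

lemma sums_matrix_exp: "(\<lambda>k. matrix_pow A k /\<^sub>R fact k) sums matrix_exp A"
proof -
  have "(\<lambda>k. matrix_pow A k /\<^sub>R fact k) sums
      (\<chi> i j. \<Sum>k. (matrix_pow A k /\<^sub>R fact k) $ i $ j)"
    by (intro sums_vecI)
      (use summable_sums[OF summable_norm_cancel[OF summable_norm_matrix_exp_entry[of A]]] in simp)
  then show ?thesis
    unfolding matrix_exp_def by (simp add: sums_iff)
qed

lemma sums_matrix_exp_entry:
  "(\<lambda>k. (matrix_pow A k /\<^sub>R fact k) $ i $ j) sums (matrix_exp A $ i $ j)"
  by (intro bounded_linear.sums[OF bounded_linear_vec_nth] sums_matrix_exp)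

text \<open>Applying a matrix to the fixed vector \<open>x\<close> is linear in the matrix, hence
  continuous in finite dimension, and so passes through the series.\<close>

lemma sums_matrix_exp_vector:
  "(\<lambda>k. (matrix_pow A k *v x) /\<^sub>R fact k) sums (matrix_exp A *v x)"
proof -
  have "linear (\<lambda>B::complex^'a^'a. B *v x)"
    by (intro linearI) (simp_all add: vec_eq_iff matrix_vector_mult_def scaleR_sum_right
        sum.distrib algebra_simps)
  then have bl: "bounded_linear (\<lambda>B::complex^'a^'a. B *v x)"
    by (simp add: linear_conv_bounded_linear)
  show ?thesis
    using bounded_linear.sums[OF bl sums_matrix_exp[of A]]
    by (simp add: linear_simps[OF bl])
qed

text \<open>The coefficient form of the differential equation E' = A E for E(s) = exp(s A).\<close>

lemma matrix_pow_Suc_entry: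
  fixes A :: "complex^'v^'v"
  shows "of_nat (Suc k) * (matrix_pow A (Suc k) /\<^sub>R fact (Suc k)) $ i $ j =
    (\<Sum>l\<in>UNIV. A $ i $ l * (matrix_pow A k /\<^sub>R fact k) $ l $ j)"
  by (simp add: matrix_matrix_mult_def scaleR_conv_of_real[where 'a=complex] sum_distrib_left
      sum_distrib_right field_simps del: of_nat_Suc)

text \<open>The binomial theorem for the commuting matrices \<open>A\<close> and
  \<open>mat d\<close>, divided by k! so that the right-hand side is a Cauchy product. By the
  Leibniz rule, that product obeys the recursion of \<open>matrix_pow_Suc_entry\<close> for
  \<open>A + mat d\<close>.\<close>

lemma matrix_pow_add_mat:
  fixes A :: "complex^'v^'v"
  shows "(matrix_pow (A + mat d) k /\<^sub>R fact k) $ i $ j =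
    (\<Sum>m\<le>k. (matrix_pow A m /\<^sub>R fact m) $ i $ j * (d ^ (k - m) /\<^sub>R fact (k - m)))"
proof (induction k arbitrary: i)
  case 0
  show ?case by simp
next
  case (Suc k)
  define f where "f m i = (matrix_pow A m /\<^sub>R fact m) $ i $ j" for m i
  define g where "g m = d ^ m /\<^sub>R fact m" for m
  have f_Suc: "of_nat (Suc m) * f (Suc m) i = (\<Sum>l\<in>UNIV. A $ i $ l * f m l)" for m i
    unfolding f_def by (rule matrix_pow_Suc_entry)
  have g_Suc: "of_nat (Suc m) * g (Suc m) = d * g m" for m
    by (simp add: g_def scaleR_conv_of_real[where 'a=complex] field_simps del: of_nat_Suc)
  have shift: "(\<Sum>l\<in>UNIV. (A + mat d) $ i $ l * z l) = (\<Sum>l\<in>UNIV. A $ i $ l * z l) + d * z i" for z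
    by (simp add: mat_def ring_distribs sum.distrib if_distrib[of "\<lambda>z. z * _"] cong: if_cong)
  have IH: "(matrix_pow (A + mat d) k /\<^sub>R fact k) $ l $ j = (\<Sum>m\<le>k. f m l * g (k - m))" for l
    using Suc[of l] by (simp add: f_def g_def)
  \<comment> \<open>Leibniz rule: the factor \<open>Suc k\<close> is split as
    \<open>m + (Suc k - m)\<close> in each term.\<close>
  have "of_nat (Suc k) * (\<Sum>m\<le>Suc k. f m i * g (Suc k - m))
      = (\<Sum>m\<le>Suc k. of_nat m * f m i * g (Suc k - m))
      + (\<Sum>m\<le>Suc k. f m i * (of_nat (Suc k - m) * g (Suc k - m)))"
    unfolding sum_distrib_left sum.distrib[symmetric]
    by (intro sum.cong) (auto simp: of_nat_diff algebra_simps)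
  \<comment> \<open>The term for \<open>m = 0\<close> vanishes, so the index shifts down by one and
    \<open>f_Suc\<close> applies.\<close>
  also have "(\<Sum>m\<le>Suc k. of_nat m * f m i * g (Suc k - m))
      = (\<Sum>m\<le>k. \<Sum>l\<in>UNIV. A $ i $ l * (f m l * g (k - m)))"
    unfolding sum.atMost_Suc_shift
    by (simp add: f_Suc sum_distrib_right mult.assoc del: of_nat_Suc)
  also have "\<dots> = (\<Sum>l\<in>UNIV. A $ i $ l * (\<Sum>m\<le>k. f m l * g (k - m)))"
    by (subst sum.swap) (simp add: sum_distrib_left)
  \<comment> \<open>Here the last term, \<open>m = Suc k\<close>, vanishes.\<close>
  also have "(\<Sum>m\<le>Suc k. f m i * (of_nat (Suc k - m) * g (Suc k - m)))
      = (\<Sum>m\<le>k. f m i * (of_nat (Suc (k - m)) * g (Suc (k - m))))"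
    by (simp add: Suc_diff_le add_diff_eq)
  also have "\<dots> = d * (\<Sum>m\<le>k. f m i * g (k - m))"
    by (simp add: g_Suc sum_distrib_left mult_ac del: of_nat_Suc)
  finally have "of_nat (Suc k) * (\<Sum>m\<le>Suc k. f m i * g (Suc k - m))
      = (\<Sum>l\<in>UNIV. A $ i $ l * (matrix_pow (A + mat d) k /\<^sub>R fact k) $ l $ j)
        + d * (matrix_pow (A + mat d) k /\<^sub>R fact k) $ i $ j"
    by (simp only: IH)
  also have "\<dots> = (\<Sum>l\<in>UNIV. (A + mat d) $ i $ l * (matrix_pow (A + mat d) k /\<^sub>R fact k) $ l $ j)"
    by (simp only: shift)
  also have "\<dots> = of_nat (Suc k) * (matrix_pow (A + mat d) (Suc k) /\<^sub>R fact (Suc k)) $ i $ j"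
    by (rule matrix_pow_Suc_entry[symmetric])
  finally show ?case
    unfolding f_def g_def mult_cancel_left by (simp only: of_nat_eq_0_iff nat.simps simp_thms)
qed

lemma matrix_exp_add_mat:
  fixes A :: "complex^'v^'v"
  shows "matrix_exp (A + mat d) = (\<chi> i j. exp d * matrix_exp A $ i $ j)"
proof -
  have "matrix_exp (A + mat d) $ i $ j = exp d * matrix_exp A $ i $ j" for i j
  proof -
    have "(\<lambda>k. (matrix_pow (A + mat d) k /\<^sub>R fact k) $ i $ j) sums
        ((\<Sum>k. (matrix_pow A k /\<^sub>R fact k) $ i $ j) * (\<Sum>k. d ^ k /\<^sub>R fact k))"
      unfolding matrix_pow_add_mat
      by (intro Cauchy_product_sums summable_norm_matrix_exp_entry summable_norm_exp)
    also have "\<dots> = matrix_exp A $ i $ j * exp d"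
      using sums_matrix_exp_entry[of A i j] by (simp add: sums_iff exp_def)
    finally show ?thesis
      using sums_matrix_exp_entry[of "A + mat d" i j] by (simp add: sums_iff mult.commute)
  qed
  then show ?thesis by (simp add: vec_eq_iff)
qed

text \<open>Invariance of \<open>S\<close> keeps every power of \<open>A\<close> applied to
  \<open>x\<close> inside \<open>S\<close>, so \<open>f\<close> intertwines all powers at
  \<open>x\<close>; being linear, hence continuous, it then respects the limit of the
  series.\<close>

lemma matrix_exp_intertwining:
  fixes A :: "complex^'v^'v" and B :: "complex^'w^'w" and f :: "complex^'v \<Rightarrow> complex^'w"
  assumes f: "linear f"
    and inv: "\<And>x. x \<in> S \<Longrightarrow> A *v x \<in> S"
    and comm: "\<And>x. x \<in> S \<Longrightarrow> B *v f x = f (A *v x)"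
    and x: "x \<in> S"
  shows "matrix_exp B *v f x = f (matrix_exp A *v x)"
proof -
  have pow: "matrix_pow A k *v x \<in> S \<and> matrix_pow B k *v f x = f (matrix_pow A k *v x)" for k
    by (induction k) (simp_all add: x inv comm flip: matrix_vector_mul_assoc)
  have bl: "bounded_linear f"
    using f by (simp add: linear_conv_bounded_linear)
  have "(\<lambda>k. (matrix_pow B k *v f x) /\<^sub>R fact k) sums f (matrix_exp A *v x)"
    using bounded_linear.sums[OF bl sums_matrix_exp_vector[of A x]]
    by (simp add: pow linear_simps[OF bl])
  then show ?thesis
    using sums_matrix_exp_vector[of B "f x"] sums_unique2 by blast
qed

section \<open>States supported on one cluster\<close>

text \<open>Extension by zero. The entry type is left open because both real states and their
  complex evolutions are embedded.\<close>

definition cluster_embed :: "'n::finite \<Rightarrow> 'a::zero^'c::finite \<Rightarrow> 'a^('n \<times> 'c)" where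
  "cluster_embed j x = (\<chi> p. if fst p = j then x $ snd p else 0)"

lemma sum_cluster:
  fixes f :: "'n::finite \<times> 'c::finite \<Rightarrow> 'a::comm_monoid_add"
  assumes "\<And>k b. k \<noteq> j \<Longrightarrow> f (k, b) = 0"
  shows "sum f UNIV = (\<Sum>b\<in>UNIV. f (j, b))"
proof -
  have "sum f UNIV = (\<Sum>k\<in>UNIV. \<Sum>b\<in>UNIV. f (k, b))"
    by (simp add: sum.cartesian_product flip: UNIV_Times_UNIV)
  also have "\<dots> = (\<Sum>k\<in>UNIV. if k = j then \<Sum>b\<in>UNIV. f (j, b) else 0)"
    using assms by (intro sum.cong) (auto intro: sum.neutral)
  finally show ?thesis by simp
qed

lemma linear_cluster_embed: "linear (cluster_embed j :: complex^'c::finite \<Rightarrow> complex^('n::finite \<times> 'c))"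
  by (intro linearI) (auto simp: cluster_embed_def vec_eq_iff)

lemma cvec_cluster_embed: "cvec (cluster_embed j x) = cluster_embed j (cvec x)"
  by (simp add: cvec_def cluster_embed_def vec_eq_iff)

lemma cluster_embed_eq_iff [simp]: "cluster_embed j x = cluster_embed j y \<longleftrightarrow> x = y"
  by (auto simp: cluster_embed_def vec_eq_iff split: if_splits)

lemma cluster_embed_zero [simp]: "cluster_embed j 0 = 0"
  by (simp add: cluster_embed_def vec_eq_iff)

lemma cluster_embed_uminus: "cluster_embed j (- x) = - cluster_embed j (x :: real^'c::finite)"
  by (simp add: cluster_embed_def vec_eq_iff)

lemma norm_cluster_embed:
  "norm (cluster_embed j x :: real^('n::finite \<times> 'c::finite)) = norm (x :: real^'c::finite)"
  unfolding norm_vec_def L2_set_def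
  by (subst sum_cluster[of j]) (auto simp: cluster_embed_def)

lemma cluster_embed_pair_state:
  "cluster_embed j (pair_state a b) = pair_state (j, a) (j, b)"
  by (auto simp: cluster_embed_def pair_state_def vec_eq_iff axis_def)

text \<open>The embedding is an injective isometry that commutes with negation.\<close>

lemma distinct_real_pure_states_cluster_embed:
  assumes "distinct_real_pure_states x y"
  shows "distinct_real_pure_states (cluster_embed j x :: real^('n::finite \<times> 'c::finite)) (cluster_embed j y)"
proof -
  have "cluster_embed j z = 0 \<longleftrightarrow> z = 0" for z :: "real^'c"
    using cluster_embed_eq_iff[of j z 0] by simp
  with assms show ?thesis
    by (simp add: distinct_real_pure_states_def norm_cluster_embed flip: cluster_embed_uminus)
qed

section \<open>State transfer in a cluster\<close>

text \<open>Only the columns of cluster \<open>j\<close> matter for states supported there. That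
  \<open>e k\<close> depends on neither \<open>a\<close> nor \<open>b\<close> reflects the constant
  weight between two clusters; that \<open>d\<close> is a scalar reflects that all vertices of
  cluster \<open>j\<close> have the same total weight into the other clusters.\<close>

lemma graph_matrix_perturbed_blow_up:
  fixes G :: "'n::finite graph" and H :: "'n \<Rightarrow> 'c::finite graph"
  obtains d e where "\<And>k a b. graph_matrix M (perturbed_blow_up G H) $ (k, a) $ (j, b) =
    (if k = j then (graph_matrix M (H j) + mat d) $ a $ b else e k)"
proof -
  \<comment> \<open>The total weight from any one vertex of cluster \<open>j\<close> into the other
    clusters.\<close>
  define D where "D = (\<Sum>k\<in>UNIV - {j}. \<Sum>b\<in>(UNIV::'c set). G j k)"
  have row: "(\<Sum>p\<in>UNIV. perturbed_blow_up G H (j, a) p) = (\<Sum>b\<in>UNIV. H j a b) + D" for a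
  proof -
    have "(\<Sum>p\<in>UNIV. perturbed_blow_up G H (j, a) p)
        = (\<Sum>k\<in>UNIV. \<Sum>b\<in>UNIV. perturbed_blow_up G H (j, a) (k, b))"
      by (simp add: sum.cartesian_product flip: UNIV_Times_UNIV)
    also have "\<dots> = (\<Sum>b\<in>UNIV. H j a b) + D"
      unfolding D_def by (subst sum.remove[of _ j])
        (auto simp: perturbed_blow_up_def blow_up_def intro!: sum.cong)
    finally show ?thesis .
  qed
  show ?thesis
  proof (cases M)
    case Adjacency
    show ?thesis
      by (rule that[of 0 "\<lambda>k. G k j"])
        (auto simp: Adjacency adjacency_matrix_def perturbed_blow_up_def blow_up_def mat_def)
  next
    case Laplacian
    show ?thesis
      by (rule that[of D "\<lambda>k. - G k j"])
        (auto simp: Laplacian adjacency_matrix_def row_sum_matrix_def row mat_def,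
         auto simp: perturbed_blow_up_def blow_up_def)
  next
    case Signless_Laplacian
    show ?thesis
      by (rule that[of D "\<lambda>k. G k j"])
        (auto simp: Signless_Laplacian adjacency_matrix_def row_sum_matrix_def row mat_def,
         auto simp: perturbed_blow_up_def blow_up_def)
  qed
qed

lemma graph_matrix_symmetric:
  "is_graph w \<Longrightarrow> graph_matrix M w $ a $ b = graph_matrix M w $ b $ a"
  by (cases M) (auto simp: is_graph_def adjacency_matrix_def row_sum_matrix_def)

text \<open>The eigenvector equation fixes the row sums, and symmetry transfers this to columns.
  Constant column sums are what makes the orthogonal complement of the all-ones vector
  invariant.\<close>

lemma graph_matrix_column_sums:
  assumes "is_graph w" and "is_eigenvector (graph_matrix M w) 1"
  obtains \<mu> where "\<And>b. (\<Sum>a\<in>UNIV. graph_matrix M w $ a $ b) = \<mu>"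
proof -
  obtain \<mu> where "graph_matrix M w *v 1 = \<mu> *s 1"
    using assms(2) by (auto simp: is_eigenvector_def)
  then have row: "(\<Sum>a\<in>UNIV. graph_matrix M w $ b $ a) = \<mu>" for b
    by (simp add: vec_eq_iff matrix_vector_mult_def)
  have "(\<Sum>a\<in>UNIV. graph_matrix M w $ a $ b) = (\<Sum>a\<in>UNIV. graph_matrix M w $ b $ a)" for b
    by (intro sum.cong refl graph_matrix_symmetric assms(1))
  then show ?thesis
    by (intro that[of \<mu>]) (simp only: row)
qed

text \<open>Intertwining along \<open>cluster_embed j\<close> on the vectors with coordinate sum
  zero, followed by splitting off the scalar shift as a phase. One \<open>d\<close> serves all times
  and states.\<close>

lemma transition_matrix_cluster_embed:
  fixes G :: "'n::finite graph" and H :: "'n \<Rightarrow> 'c::finite graph"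
  assumes "is_graph (H j)" and "is_eigenvector (graph_matrix M (H j)) 1"
  obtains d where "\<And>t x. x \<bullet> 1 = 0 \<Longrightarrow>
    transition_matrix M (perturbed_blow_up G H) t *v cvec (cluster_embed j x) =
    cis (t * d) *s cluster_embed j (transition_matrix M (H j) t *v cvec x)"
proof -
  let ?X = "perturbed_blow_up G H"
  obtain d e where entries: "\<And>k a b. graph_matrix M ?X $ (k, a) $ (j, b) =
    (if k = j then (graph_matrix M (H j) + mat d) $ a $ b else e k)"
    using graph_matrix_perturbed_blow_up by metis
  obtain \<mu> where \<mu>: "\<And>b. (\<Sum>a\<in>UNIV. graph_matrix M (H j) $ a $ b) = \<mu>"
    using graph_matrix_column_sums assms by metis
  show ?thesis
  proof (rule that[of d])
    fix t :: real and x :: "real^'c"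
    assume x: "x \<bullet> 1 = 0"
    \<comment> \<open>The complexified orthogonal complement of the all-ones vector.\<close>
    define S where "S = {v :: complex^'c. (\<Sum>a\<in>UNIV. v $ a) = 0}"
    define A where "A = map_matrix (\<lambda>m. \<i> * complex_of_real t * complex_of_real m) (graph_matrix M (H j))"
    define B where "B = map_matrix (\<lambda>m. \<i> * complex_of_real t * complex_of_real m) (graph_matrix M ?X)"
    define \<delta> where "\<delta> = \<i> * complex_of_real t * complex_of_real d"
    have inv: "(A + mat \<delta>) *v v \<in> S" if "v \<in> S" for v
    proof -
      \<comment> \<open>Summing by columns: each column of \<open>A\<close> has the same sum, which
        leaves a multiple of the coordinate sum of \<open>v\<close>.\<close>
      have "(\<Sum>a\<in>UNIV. (A *v v) $ a) = (\<Sum>b\<in>UNIV. (\<Sum>a\<in>UNIV. A $ a $ b) * v $ b)"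
        by (simp add: matrix_vector_mult_def sum_distrib_right) (rule sum.swap)
      also have "\<dots> = (\<Sum>b\<in>UNIV. \<i> * t * \<mu> * v $ b)"
        by (simp add: A_def \<mu> flip: sum_distrib_left of_real_sum)
      also have "\<dots> = 0"
        using that by (simp add: S_def flip: sum_distrib_left)
      moreover have "mat \<delta> *v v = \<delta> *s v"
        by (simp add: vec_eq_iff matrix_vector_mult_def mat_def if_distrib[of "\<lambda>z. z * _"] cong: if_cong)
      ultimately show ?thesis
        using that by (simp add: S_def matrix_vector_mult_add_rdistrib sum.distrib flip: sum_distrib_left)
    qed
    have comm: "B *v cluster_embed j v = cluster_embed j ((A + mat \<delta>) *v v)" if "v \<in> S" for v
    proof -
      have "(B *v cluster_embed j v) $ (k, a) = cluster_embed j ((A + mat \<delta>) *v v) $ (k, a)" for k a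
      proof -
        have "(B *v cluster_embed j v) $ (k, a) = (\<Sum>b\<in>UNIV. B $ (k, a) $ (j, b) * v $ b)"
          unfolding matrix_vector_mult_def
          by (simp, subst sum_cluster[of j]) (auto simp: cluster_embed_def)
        also have "\<dots> = cluster_embed j ((A + mat \<delta>) *v v) $ (k, a)"
        proof (cases "k = j")
          case True
          then show ?thesis
            by (auto simp: A_def B_def \<delta>_def map_matrix_def entries cluster_embed_def
                matrix_vector_mult_def mat_def algebra_simps intro!: sum.cong)
        next
          \<comment> \<open>No leakage: a row outside cluster \<open>j\<close> is constant on the
            columns of that cluster, so it returns a multiple of the coordinate sum of
            \<open>v\<close>, which is 0.\<close>
          case False
          then show ?thesis
            using that by (simp add: B_def map_matrix_def entries cluster_embed_def S_def
                flip: sum_distrib_left)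
        qed
        finally show ?thesis .
      qed
      then show ?thesis by (simp add: vec_eq_iff)
    qed
    have "cvec x \<in> S"
      using x by (simp add: S_def cvec_def inner_vec_def flip: of_real_sum)
    then have "matrix_exp B *v cluster_embed j (cvec x)
        = cluster_embed j (matrix_exp (A + mat \<delta>) *v cvec x)"
      using matrix_exp_intertwining[OF linear_cluster_embed inv comm] by blast
    also have "\<dots> = exp \<delta> *s cluster_embed j (matrix_exp A *v cvec x)"
      by (simp add: matrix_exp_add_mat vec_eq_iff cluster_embed_def matrix_vector_mult_def
          sum_distrib_left mult.assoc)
    also have "exp \<delta> = cis (t * d)"
      by (simp add: \<delta>_def cis_conv_exp mult.assoc)
    finally show "transition_matrix M ?X t *v cvec (cluster_embed j x) =
        cis (t * d) *s cluster_embed j (transition_matrix M (H j) t *v cvec x)"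
      by (simp add: transition_matrix_def A_def B_def cvec_cluster_embed)
  qed
qed

text \<open>The same time \<open>\<tau>\<close> works; the phase is absorbed into the scalar
  factor.\<close>

lemma PST_cluster_embed:
  fixes G :: "'n::finite graph" and H :: "'n \<Rightarrow> 'c::finite graph"
  assumes "is_graph (H j)" and "is_eigenvector (graph_matrix M (H j)) 1"
    and "x \<bullet> 1 = 0" and "PST M (H j) x y"
  shows "PST M (perturbed_blow_up G H) (cluster_embed j x) (cluster_embed j y)"
proof -
  obtain d where d: "\<And>t x. x \<bullet> 1 = 0 \<Longrightarrow>
    transition_matrix M (perturbed_blow_up G H) t *v cvec (cluster_embed j x) =
    cis (t * d) *s cluster_embed j (transition_matrix M (H j) t *v cvec x)"
    using assms(1,2)
    by (rule transition_matrix_cluster_embed[where G = G and H = H and j = j and M = M])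
      (rule that)
  obtain \<tau> \<gamma> where "\<tau> > 0" and "transition_matrix M (H j) \<tau> *v cvec x = \<gamma> *s cvec y"
    using assms(4) by (auto simp: PST_def)
  then have "transition_matrix M (perturbed_blow_up G H) \<tau> *v cvec (cluster_embed j x)
      = (cis (\<tau> * d) * \<gamma>) *s cvec (cluster_embed j y)"
    unfolding d[OF assms(3)] by (simp add: cvec_cluster_embed) (simp add: vec_eq_iff cluster_embed_def)
  with \<open>\<tau> > 0\<close> assms(4) show ?thesis
    by (auto simp: PST_def intro: distinct_real_pure_states_cluster_embed)
qed

text \<open>Now the phase varies along the sequence of times. Compactness of the unit circle makes
  it converge to some \<open>l\<close> along a subsequence, and the limiting scalar is
  \<open>l * \<gamma>\<close>.\<close>

lemma PGST_cluster_embed: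
  fixes G :: "'n::finite graph" and H :: "'n \<Rightarrow> 'c::finite graph"
  assumes "is_graph (H j)" and "is_eigenvector (graph_matrix M (H j)) 1"
    and "x \<bullet> 1 = 0" and "PGST M (H j) x y"
  shows "PGST M (perturbed_blow_up G H) (cluster_embed j x) (cluster_embed j y)"
proof -
  let ?U = "transition_matrix M (H j)" and ?V = "transition_matrix M (perturbed_blow_up G H)"
  obtain d where d: "\<And>t x. x \<bullet> 1 = 0 \<Longrightarrow>
    ?V t *v cvec (cluster_embed j x) = cis (t * d) *s cluster_embed j (?U t *v cvec x)"
    using assms(1,2)
    by (rule transition_matrix_cluster_embed[where G = G and H = H and j = j and M = M])
      (rule that)
  obtain t \<gamma> where t: "(\<lambda>k. ?U (t k) *v cvec x) \<longlonglongrightarrow> \<gamma> *s cvec y"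
    using assms(4) by (auto simp: PGST_def)
  \<comment> \<open>The phases need not converge along t, only along a subsequence.\<close>
  have "\<forall>k. cis (t k * d) \<in> sphere 0 1"
    by simp
  then obtain l r where r: "strict_mono (r :: nat \<Rightarrow> nat)"
    and l: "(\<lambda>k. cis (t (r k) * d)) \<longlonglongrightarrow> l"
    by (rule seq_compactE[OF compact_imp_seq_compact[OF compact_sphere], unfolded o_def])
  have "(\<lambda>k. ?U (t (r k)) *v cvec x) \<longlonglongrightarrow> \<gamma> *s cvec y"
    using LIMSEQ_subseq_LIMSEQ[OF t r] by (simp add: o_def)
  then have lim: "(\<lambda>k. (?U (t (r k)) *v cvec x) $ a) \<longlonglongrightarrow> (\<gamma> *s cvec y) $ a" for a
    by (rule tendsto_vec_nth)
  have "(\<lambda>k. ?V (t (r k)) *v cvec (cluster_embed j x)) \<longlonglongrightarrow> (l * \<gamma>) *s cvec (cluster_embed j y)"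
    unfolding d[OF assms(3)] unfolding cvec_cluster_embed
  proof (rule vec_tendstoI)
    \<comment> \<open>Inside the cluster this is a product of limits; outside it both sides are
      0.\<close>
    fix p :: "'n \<times> 'c"
    show "(\<lambda>k. (cis (t (r k) * d) *s cluster_embed j (?U (t (r k)) *v cvec x)) $ p)
        \<longlonglongrightarrow> ((l * \<gamma>) *s cluster_embed j (cvec y)) $ p"
      using tendsto_mult[OF l lim[of "snd p"]] by (auto simp: cluster_embed_def mult.assoc)
  qed
  moreover have "distinct_real_pure_states x y"
    using assms(4) by (simp add: PGST_def)
  ultimately show ?thesis
    unfolding PGST_def
    by (intro conjI exI[of _ "\<lambda>k. t (r k)"] exI[of _ "l * \<gamma>"] distinct_real_pure_states_cluster_embed)
qed

text \<open>This makes the pair-state claims instances of the general transfer results.\<close>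

lemma pair_state_orthogonal_one: "pair_state a b \<bullet> 1 = 0"
  by (simp add: pair_state_def inner_diff_left inner_axis')

theorem theorem20:
  fixes G :: "'n::finite graph"
    and H :: "'n \<Rightarrow> 'c::finite graph"
    and M :: hamiltonian
  assumes "is_graph G"
    and "\<And>j. is_graph (H j)"
    and "CARD('c) \<ge> 2"
  shows "((\<exists>j. is_eigenvector (graph_matrix M (H j)) 1 \<and>
             (\<exists>x y. x \<bullet> 1 = 0 \<and> y \<bullet> 1 = 0 \<and> PST M (H j) x y))
           \<longrightarrow> (\<exists>x y. PST M (perturbed_blow_up G H) x y)) \<and>
         ((\<exists>j. is_eigenvector (graph_matrix M (H j)) 1 \<and>
             (\<exists>x y. x \<bullet> 1 = 0 \<and> y \<bullet> 1 = 0 \<and> PGST M (H j) x y))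
           \<longrightarrow> (\<exists>x y. PGST M (perturbed_blow_up G H) x y)) \<and>
         ((\<exists>j. is_eigenvector (graph_matrix M (H j)) 1 \<and> pair_PST M (H j))
           \<longrightarrow> pair_PST M (perturbed_blow_up G H)) \<and>
         ((\<exists>j. is_eigenvector (graph_matrix M (H j)) 1 \<and> pair_PGST M (H j))
           \<longrightarrow> pair_PGST M (perturbed_blow_up G H))"
proof (intro conjI impI)
  show "\<exists>x y. PST M (perturbed_blow_up G H) x y"
    if "\<exists>j. is_eigenvector (graph_matrix M (H j)) 1 \<and>
      (\<exists>x y. x \<bullet> 1 = 0 \<and> y \<bullet> 1 = 0 \<and> PST M (H j) x y)"
    using that PST_cluster_embed[where G = G and H = H, OF assms(2)] by blast
  show "\<exists>x y. PGST M (perturbed_blow_up G H) x y"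
    if "\<exists>j. is_eigenvector (graph_matrix M (H j)) 1 \<and>
      (\<exists>x y. x \<bullet> 1 = 0 \<and> y \<bullet> 1 = 0 \<and> PGST M (H j) x y)"
    using that PGST_cluster_embed[where G = G and H = H, OF assms(2)] by blast
  show "pair_PST M (perturbed_blow_up G H)"
    if pair: "\<exists>j. is_eigenvector (graph_matrix M (H j)) 1 \<and> pair_PST M (H j)"
  proof -
    obtain j a b p q where "is_eigenvector (graph_matrix M (H j)) 1" "a \<noteq> b" "p \<noteq> q"
      "PST M (H j) (pair_state a b) (pair_state p q)"
      using pair by (auto simp: pair_PST_def)
    \<comment> \<open>An embedded pair state is again a pair state, on the vertices
      \<open>(j, a)\<close> and \<open>(j, b)\<close>, which differ because \<open>a\<close> and
      \<open>b\<close> do.\<close>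
    then have "PST M (perturbed_blow_up G H) (pair_state (j, a) (j, b)) (pair_state (j, p) (j, q))"
      using PST_cluster_embed[where G = G and H = H, OF assms(2) _ pair_state_orthogonal_one]
      unfolding cluster_embed_pair_state[symmetric] by blast
    with \<open>a \<noteq> b\<close> \<open>p \<noteq> q\<close> show ?thesis
      unfolding pair_PST_def by blast
  qed
  show "pair_PGST M (perturbed_blow_up G H)"
    if pair: "\<exists>j. is_eigenvector (graph_matrix M (H j)) 1 \<and> pair_PGST M (H j)"
  proof -
    obtain j a b p q where "is_eigenvector (graph_matrix M (H j)) 1" "a \<noteq> b" "p \<noteq> q"
      "PGST M (H j) (pair_state a b) (pair_state p q)"
      using pair by (auto simp: pair_PGST_def)
    then have "PGST M (perturbed_blow_up G H) (pair_state (j, a) (j, b)) (pair_state (j, p) (j, q))"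
      using PGST_cluster_embed[where G = G and H = H, OF assms(2) _ pair_state_orthogonal_one]
      unfolding cluster_embed_pair_state[symmetric] by blast
    with \<open>a \<noteq> b\<close> \<open>p \<noteq> q\<close> show ?thesis
      unfolding pair_PGST_def by blast
  qed
qed

end
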